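(* Let $\vec{a}=(a_1,a_2,\dots,a_n)$ be a non-decreasing sequence of positive integers, and let $$I_{\vec{a}}(q)=\sum_{(b_1,\dots,b_n)\in\mathcal{P}_{\vec{a}}} q^{b_1+b_2+\cdots+b_n-n}.$$ Then $$I_{\vec{a}}(-1)=\begin{cases}0, & \text{if } a_1 \text{ is even},\\ (-1)^{a_1+\cdots+a_n-n}\cdot \beta_n(S), & \text{if } a_1 \text{ is odd},\end{cases}$$ where $S=\{i\in[n-1] : a_{i+1}\text{ is odd}\}$.
   Context: For a non-decreasing sequence $\vec{a}=(a_1,\dots,a_n)$ of positive integers, a sequence $(b_1,\dots,b_n)$ of positive integers is an $\vec{a}$-parking function if its increasing rearrangement $b_1'\le b_2'\le\cdots\le b_n'$ satisfies $b_i'\le a_i$ for all $i$; $\mathcal{P}_{\vec{a}}$ denotes the set of all $\vec{a}$-parking functions. For $S\subseteq[n-1]$, $\beta_n(S)$ denotes the number of permutations $w_1w_2\cdots w_n$ of $[n]=\{1,\dots,n\}$ whose descent set $\{i\in[n-1]: w_i>w_{i+1}\}$ equals $S$. *)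

theory Defs
  imports
    "HOL-Combinatorics.Permutations"
    "HOL-Computational_Algebra.Polynomial"
begin

text \<open>
  A finite sequence \<open>(a\<^sub>1, \<dots>, a\<^sub>n)\<close> is the list \<open>a\<close> of length \<open>n\<close>, so \<open>a\<^sub>i\<close> is \<open>a ! (i - 1)\<close>.
  Permutations of \<open>[n]\<close> and their descents keep the one-based indexing by \<open>{1..n}\<close>.
\<close>

definition parking_functions :: "nat list \<Rightarrow> nat list set" where
  "parking_functions a =
     {b. length b = length a \<and> (\<forall>x\<in>set b. 0 < x) \<and> (\<forall>i<length a. sort b ! i \<le> a ! i)}"

text \<open>The truncated subtraction is exact, since the entries of \<open>b\<close> are positive.\<close>

definition parking_enumerator :: "nat list \<Rightarrow> int poly" where
  "parking_enumerator a = (\<Sum>b\<in>parking_functions a. monom 1 (sum_list b - length a))"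

definition descent_set :: "nat \<Rightarrow> (nat \<Rightarrow> nat) \<Rightarrow> nat set" where
  "descent_set n w = {i \<in> {1..<n}. w i > w (i + 1)}"

definition beta :: "nat \<Rightarrow> nat set \<Rightarrow> nat" where
  "beta n S = card {w. w permutes {1..n} \<and> descent_set n w = S}"

text \<open>Finiteness of the index set, so that the sum above is a genuine finite sum.\<close>

lemma finite_parking_functions: "finite (parking_functions a)"
proof (rule finite_subset)
  show "parking_functions a \<subseteq> {b. set b \<subseteq> {..Max (set a)} \<and> length b = length a}"
  proof
    fix b assume b: "b \<in> parking_functions a"
    have "x \<le> Max (set a)" if x: "x \<in> set b" for x
    proof -
      from x have "x \<in> set (sort b)" by simp
      then obtain i where i: "i < length b" "x = sort b ! i"
        by (metis in_set_conv_nth length_sort)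
      with b have "x \<le> a ! i" "a ! i \<in> set a" by (auto simp: parking_functions_def)
      then show ?thesis by (meson List.finite_set Max_ge order_trans)
    qed
    with b show "b \<in> {b. set b \<subseteq> {..Max (set a)} \<and> length b = length a}"
      by (auto simp: parking_functions_def)
  qed
  show "finite {b. set b \<subseteq> {..Max (set a)} \<and> length b = length a}"
    by (rule finite_lists_length_eq) simp
qed

end

theory Submission
  imports Defs "HOL-Combinatorics.Multiset_Permutations" "HOL-Library.FuncSet"
begin

text \<open>
  Weight an entry \<open>x\<close> by \<open>(-1)\<^sup>x\<^sup>-\<^sup>1\<close> and let \<open>N\<close> be even and above all the bounds, so that the weights
  of \<open>1, \<dots>, N\<close> cancel and those of \<open>m + 1, \<dots>, N\<close> add up to \<open>-1\<close> for odd \<open>m\<close> and to \<open>0\<close> for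
  even \<open>m\<close>. Cutting an arbitrary map into \<open>{1..N}\<close> at its first violation of the parking condition
  gives a Goncarov-type recursion for the signed count \<open>F(I)\<close> of the parking maps on a
  finite index set \<open>I\<close>: \<open>F(I)\<close> is minus the sum of \<open>(-1)\<^bsup>|I - A|\<^esup> F(A)\<close> over the proper subsets \<open>A\<close>
  with \<open>a\<close> odd at position \<open>|A| + 1\<close>. Up to sign this is the inclusion-exclusion recursion for the
  number of arrangements of \<open>I\<close> with a given descent set, obtained by splitting an
  arrangement after its last descent. Working with all finite sets \<open>I\<close> instead of \<open>{1..n}\<close> turns
  the binomial coefficients into sums over subsets.
\<close>

section \<open>Arrangements of a finite set with prescribed descents\<close>

text \<open>Positions count from 1, as in \<open>descent_set\<close>, whereas list entries are
  indexed from 0.\<close>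

definition descents :: "nat list \<Rightarrow> nat set" where
  "descents xs = {i \<in> {1..<length xs}. xs ! (i - 1) > xs ! i}"

definition perms_with_descents :: "nat set \<Rightarrow> nat set \<Rightarrow> nat list set" where
  "perms_with_descents A T = {xs \<in> permutations_of_set A. descents xs = T}"

lemma finite_perms_with_descents [simp]: "finite (perms_with_descents A T)"
  by (cases "finite A") (auto simp: perms_with_descents_def permutations_of_set_infinite)

lemma descents_eq_empty_iff: "descents xs = {} \<longleftrightarrow> sorted xs"
proof -
  have "descents xs = {} \<longleftrightarrow> (\<forall>i. Suc i < length xs \<longrightarrow> xs ! i \<le> xs ! Suc i)" (is "_ \<longleftrightarrow> ?R")
  proof
    assume *: "descents xs = {}"
    show ?R
    proof (intro allI impI)
      fix i assume "Suc i < length xs"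
      moreover have "Suc i \<notin> descents xs" using * by simp
      ultimately show "xs ! i \<le> xs ! Suc i" by (auto simp: descents_def)
    qed
  next
    assume R: ?R
    show "descents xs = {}"
      unfolding descents_def
    proof safe
      fix i assume "i \<in> {1..<length xs}" "xs ! i < xs ! (i - 1)"
      then show "i \<in> {}" using R[rule_format, of "i - 1"] by simp
    qed
  qed
  also have "\<dots> \<longleftrightarrow> sorted xs" by (simp add: sorted_iff_nth_Suc)
  finally show ?thesis .
qed

lemma perms_with_descents_empty:
  assumes "finite A"
  shows "perms_with_descents A {} = {sorted_list_of_set A}"
proof -
  have "sorted xs \<and> distinct xs \<and> set xs = A \<longleftrightarrow> xs = sorted_list_of_set A" for xs
    using assms by (metis sorted_list_of_set.idem_if_sorted_distinct
        sorted_list_of_set.distinct_sorted_key_list_of_set sorted_list_of_set.set_sorted_key_list_of_set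
        sorted_list_of_set.sorted_sorted_key_list_of_set list.map_ident)
  then show ?thesis
    unfolding perms_with_descents_def permutations_of_set_def descents_eq_empty_iff by blast
qed

text \<open>Apart from the seam \<open>length ys\<close>, the descents are those of
  \<open>ys\<close> and the shifted ones of \<open>zs\<close>. The latter lie beyond the seam, where
  \<open>T\<close> has no element.\<close>

lemma descents_append:
  assumes "T \<subseteq> {1..<length ys}"
  shows "descents (ys @ zs) - {length ys} = T \<longleftrightarrow> descents ys = T \<and> sorted zs"
proof -
  let ?m = "length ys"
  have eq: "descents (ys @ zs) - {?m} = descents ys \<union> (\<lambda>i. i + ?m) ` descents zs"
  proof (intro set_eqI)
    fix i
    consider "i < ?m" | "i = ?m" | "i > ?m" by linarith
    then show "i \<in> descents (ys @ zs) - {?m} \<longleftrightarrow> i \<in> descents ys \<union> (\<lambda>i. i + ?m) ` descents zs"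
    proof cases
      case 1
      then show ?thesis by (auto simp: descents_def nth_append)
    next
      case 2
      then show ?thesis by (auto simp: descents_def)
    next
      case 3
      then have "i = (i - ?m) + ?m" by simp
      then have "i \<in> (\<lambda>i. i + ?m) ` descents zs \<longleftrightarrow> i - ?m \<in> descents zs"
        by (metis (no_types, lifting) add_diff_cancel_right' image_iff)
      with 3 show ?thesis by (auto simp: descents_def nth_append diff_right_commute)
    qed
  qed
  have "(\<lambda>i. i + ?m) ` descents zs \<inter> {1..<?m} = {}" "descents ys \<subseteq> {1..<?m}"
    by (auto simp: descents_def)
  then have "descents ys \<union> (\<lambda>i. i + ?m) ` descents zs = T
      \<longleftrightarrow> descents ys = T \<and> (\<lambda>i. i + ?m) ` descents zs = {}"
    using assms by (smt (verit, ccfv_SIG) Int_Un_distrib2 Un_empty_right inf.orderE inf_commute Un_upper2 inf.absorb_iff2)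
  with eq show ?thesis by (simp add: descents_eq_empty_iff)
qed

text \<open>Cut after position \<open>m\<close>. The prefix is an arrangement of some
  \<open>B\<close> with descent set \<open>T\<close>, and the rest is sorted, hence determined by
  \<open>B\<close>. The seam \<open>m\<close> may or may not be a descent, which accounts for the
  two terms on the left.\<close>

lemma card_perms_with_descents_insert:
  assumes fin: "finite A" and T: "T \<subseteq> {1..<m}" and m: "1 \<le> m" "m < card A"
  shows "card (perms_with_descents A (insert m T)) + card (perms_with_descents A T)
    = (\<Sum>B | B \<subseteq> A \<and> card B = m. card (perms_with_descents B T))"
proof -
  let ?X = "perms_with_descents A (insert m T) \<union> perms_with_descents A T"
  let ?Y = "SIGMA B:{B. B \<subseteq> A \<and> card B = m}. perms_with_descents B T"
  have "m \<notin> T" using T by auto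
  then have X: "?X = {xs \<in> permutations_of_set A. descents xs - {m} = T}"
    by (auto simp: perms_with_descents_def)
  have split: "xs = take m xs @ drop m xs" "length (take m xs) = m"
    if "xs \<in> permutations_of_set A" for xs
    using that m length_finite_permutations_of_set[of xs A] by auto
  have "card ?X = card ?Y"
  proof (rule bij_betw_same_card, rule bij_betw_byWitness)
    let ?f = "\<lambda>xs. (set (take m xs), take m xs)"
    let ?g = "\<lambda>(B, ys). ys @ sorted_list_of_set (A - B)"
    show "\<forall>xs\<in>?X. ?g (?f xs) = xs"
    proof
      fix xs assume "xs \<in> ?X"
      then have xs: "xs \<in> permutations_of_set A" "descents (take m xs @ drop m xs) - {length (take m xs)} = T"
        using X split by auto
      then have s: "sorted (drop m xs)" using descents_append split(2) T by metis
      have "distinct (take m xs @ drop m xs)" "A = set (take m xs @ drop m xs)"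
        unfolding append_take_drop_id using xs by (auto simp: permutations_of_set_def)
      then have "A - set (take m xs) = set (drop m xs)" "distinct (drop m xs)"
        unfolding set_append distinct_append by blast+
      then show "?g (?f xs) = xs"
        using s by (simp add: sorted_list_of_set.idem_if_sorted_distinct)
    qed
    show "\<forall>p\<in>?Y. ?f (?g p) = p"
    proof
      fix p assume "p \<in> ?Y"
      then obtain B ys where p: "p = (B, ys)" "set ys = B" "distinct ys" "card B = m"
        by (auto simp: perms_with_descents_def permutations_of_set_def)
      then have "length ys = m" using distinct_card by fastforce
      with p show "?f (?g p) = p" by simp
    qed
    show "?f ` ?X \<subseteq> ?Y"
    proof
      fix p assume "p \<in> ?f ` ?X"
      then obtain xs where p: "p = ?f xs" and "xs \<in> ?X" by blast
      then have xs: "xs \<in> permutations_of_set A" "descents (take m xs @ drop m xs) - {length (take m xs)} = T"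
        using X split by auto
      then have "descents (take m xs) = T" using descents_append split(2) T by metis
      moreover have "card (set (take m xs)) = m"
        using xs(1) split(2) by (metis distinct_card distinct_take permutations_of_setD(2))
      moreover have "set (take m xs) \<subseteq> A"
        using xs(1) by (metis permutations_of_setD(1) set_take_subset)
      ultimately show "p \<in> ?Y" using xs(1)
        by (auto simp: p perms_with_descents_def permutations_of_set_def)
    qed
    show "?g ` ?Y \<subseteq> ?X"
    proof
      fix xs assume "xs \<in> ?g ` ?Y"
      then obtain B ys where xs: "xs = ys @ sorted_list_of_set (A - B)"
        and B: "B \<subseteq> A" "card B = m" and ys: "set ys = B" "distinct ys" "descents ys = T"
        by (auto simp: perms_with_descents_def permutations_of_set_def)
      have "length ys = m" using B ys distinct_card by fastforce
      then have "descents xs - {m} = T"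
        using ys(3) T descents_append[of T ys "sorted_list_of_set (A - B)"] by (simp add: xs)
      moreover have "xs \<in> permutations_of_set A"
        using xs B ys fin by (auto simp: permutations_of_set_def)
      ultimately show "xs \<in> ?X" unfolding X by blast
    qed
  qed
  moreover have "card ?X = card (perms_with_descents A (insert m T)) + card (perms_with_descents A T)"
    by (rule card_Un_disjoint) (use \<open>m \<notin> T\<close> in \<open>auto simp: perms_with_descents_def\<close>)
  moreover have "card ?Y = (\<Sum>B | B \<subseteq> A \<and> card B = m. card (perms_with_descents B T))"
    by (rule card_SigmaI) (use fin in auto)
  ultimately show ?thesis by simp
qed

text \<open>Induction on the largest element \<open>m\<close>: by
  \<open>card_perms_with_descents_insert\<close>, the count for \<open>insert m T\<close> is the
  term \<open>k = m\<close> minus the count for \<open>T\<close>. Expanding the latter flips every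
  sign, just as \<open>m\<close> adds one element above each \<open>k\<close>.\<close>

lemma card_perms_with_descents_recursion:
  assumes "finite A" "finite S" "S \<subseteq> {1..<card A}"
  shows "int (card (perms_with_descents A S)) =
    (\<Sum>k\<in>insert 0 S. (-1) ^ card {s \<in> S. k < s} *
      (\<Sum>B | B \<subseteq> A \<and> card B = k. int (card (perms_with_descents B (S \<inter> {..<k})))))"
  using assms(2,3)
proof (induction S rule: finite_linorder_max_induct)
  case empty
  have "{B. B \<subseteq> A \<and> card B = 0} = {{}}" using assms(1) by (auto dest: finite_subset)
  then show ?case using assms(1) by (simp add: perms_with_descents_empty)
next
  case (insert m T)
  let ?G = "\<lambda>S k. (\<Sum>B | B \<subseteq> A \<and> card B = k. int (card (perms_with_descents B (S \<inter> {..<k}))))"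
  have m: "1 \<le> m" "m < card A" and T: "T \<subseteq> {1..<m}" using insert by auto
  have "insert m T \<inter> {..<m} = T" using T by auto
  then have top: "?G (insert m T) m = int (card (perms_with_descents A (insert m T)))
      + int (card (perms_with_descents A T))"
    using card_perms_with_descents_insert[OF assms(1) T m] by (metis of_nat_add of_nat_sum)
  have low: "(-1) ^ card {s \<in> insert m T. k < s} * ?G (insert m T) k
      = - ((-1) ^ card {s \<in> T. k < s} * ?G T k)" if "k \<in> insert 0 T" for k
  proof -
    have k: "k < m" using that T m by auto
    then have "{s \<in> insert m T. k < s} = insert m {s \<in> T. k < s}" "m \<notin> {s \<in> T. k < s}"
      "insert m T \<inter> {..<k} = T \<inter> {..<k}"
      using insert.hyps by auto
    then show ?thesis using insert.hyps(1) by simp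
  qed
  have nm: "m \<notin> insert 0 T" using m T by auto
  have e: "card {s \<in> insert m T. m < s} = 0" using T by (auto simp: card_eq_0_iff)
  have "(\<Sum>k\<in>insert 0 (insert m T). (-1) ^ card {s \<in> insert m T. k < s} * ?G (insert m T) k)
      = ?G (insert m T) m + (\<Sum>k\<in>insert 0 T. (-1) ^ card {s \<in> insert m T. k < s} * ?G (insert m T) k)"
    using nm insert.hyps(1) unfolding insert_commute[of 0 m T] by (subst sum.insert) (simp_all only: e, auto)
  also have "\<dots> = ?G (insert m T) m - (\<Sum>k\<in>insert 0 T. (-1) ^ card {s \<in> T. k < s} * ?G T k)"
    using low by (simp only: sum.cong[OF refl low] sum_negf)
  also have "\<dots> = ?G (insert m T) m - int (card (perms_with_descents A T))"
    using insert by auto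
  finally show ?case using top by simp
qed

text \<open>A permutation corresponds to the list of its values; injectivity and equal cardinality
  make this a bijection onto all arrangements of \<open>{1..n}\<close>.\<close>

lemma beta_eq_card_perms_with_descents: "beta n S = card (perms_with_descents {1..n} S)"
proof -
  let ?f = "\<lambda>w. map w [1..<Suc n]"
  let ?P = "{w. w permutes {1..n}}"
  have inj: "inj_on ?f ?P"
  proof (rule inj_onI)
    fix v w assume "v \<in> ?P" "w \<in> ?P" "?f v = ?f w"
    then have "v i = w i" if "i \<in> {1..n}" for i
      using that by (auto simp del: upt_Suc)
    with \<open>v \<in> ?P\<close> \<open>w \<in> ?P\<close> show "v = w"
      by (metis mem_Collect_eq permutes_not_in ext)
  qed
  have sub: "?f ` ?P \<subseteq> permutations_of_set {1..n}"
  proof (intro image_subsetI permutations_of_setI)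
    fix w assume "w \<in> ?P"
    then have w: "w permutes {1..n}" by simp
    have "set (?f w) = w ` {1..n}" by (simp only: set_map set_upt atLeastLessThanSuc_atLeastAtMost)
    then show "set (?f w) = {1..n}" using permutes_image[OF w] by simp
    show "distinct (?f w)"
      using permutes_inj_on[OF w] by (simp add: distinct_map del: upt_Suc)
  qed
  have img: "?f ` ?P = permutations_of_set {1..n}"
  proof (rule card_subset_eq[OF _ sub])
    show "card (?f ` ?P) = card (permutations_of_set {1..n})"
      unfolding card_image[OF inj] by (simp add: card_permutations)
  qed simp
  have desc: "descents (?f w) = descent_set n w" for w
    by (auto simp: descents_def descent_set_def nth_append simp del: upt_Suc)
  have "?f ` {w \<in> ?P. descent_set n w = S} = perms_with_descents {1..n} S"
    unfolding perms_with_descents_def img[symmetric] desc[symmetric] by blast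
  moreover have "card (?f ` {w \<in> ?P. descent_set n w = S}) = card {w \<in> ?P. descent_set n w = S}"
    by (rule card_image[OF inj_on_subset[OF inj]]) blast
  ultimately have "card (perms_with_descents {1..n} S) = card {w \<in> ?P. descent_set n w = S}"
    by (simp only:)
  then show ?thesis by (simp add: beta_def)
qed

section \<open>Signed counts of parking maps\<close>

text \<open>The bounds are indexed from \<open>0\<close>. That at least \<open>i + 1\<close> values are at most \<open>a i\<close> means that
  entry \<open>i\<close> of the increasing rearrangement is at most \<open>a i\<close>.\<close>

definition parking_maps :: "nat \<Rightarrow> (nat \<Rightarrow> nat) \<Rightarrow> nat set \<Rightarrow> (nat \<Rightarrow> nat) set" where
  "parking_maps N a I = {f \<in> I \<rightarrow>\<^sub>E {1..N}. \<forall>i<card I. i < card {j \<in> I. f j \<le> a i}}"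

text \<open>For positive values the exponent \<open>f j + 1\<close> has the parity of
  \<open>f j - 1\<close> and avoids truncated subtraction.\<close>

definition signed_count :: "nat \<Rightarrow> (nat \<Rightarrow> nat) \<Rightarrow> nat set \<Rightarrow> int" where
  "signed_count N a I = (\<Sum>f\<in>parking_maps N a I. \<Prod>j\<in>I. (-1) ^ (f j + 1))"

lemma signed_count_empty: "signed_count N a {} = 1"
  by (simp add: signed_count_def parking_maps_def)

lemma restrict_in_parking_maps_iff:
  assumes "f \<in> I \<rightarrow>\<^sub>E {1..N}" "A \<subseteq> I"
  shows "restrict f A \<in> parking_maps N a A \<longleftrightarrow> (\<forall>i<card A. i < card {j \<in> A. f j \<le> a i})"
proof -
  have "{j \<in> A. restrict f A j \<le> a i} = {j \<in> A. f j \<le> a i}" for i by auto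
  moreover have "restrict f A \<in> A \<rightarrow>\<^sub>E {1..N}" using assms by (auto simp: PiE_iff)
  ultimately show ?thesis by (simp add: parking_maps_def)
qed

text \<open>\<open>A\<close> consists of the indices whose values precede the first violation of the parking
  condition in the increasing rearrangement of \<open>f\<close>.\<close>

lemma ex1_maximal_parking_part:
  assumes I: "finite I" and a: "mono a" and f: "f \<in> I \<rightarrow>\<^sub>E {1..N}"
  shows "\<exists>!A. A \<subseteq> I \<and> restrict f A \<in> parking_maps N a A \<and> (\<forall>j\<in>I - A. a (card A) < f j)"
proof -
  let ?c = "\<lambda>i. {j \<in> I. f j \<le> a i}"
  let ?P = "\<lambda>A. A \<subseteq> I \<and> (\<forall>i<card A. i < card {j \<in> A. f j \<le> a i}) \<and> (\<forall>j\<in>I - A. a (card A) < f j)"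
  have fin: "finite (?c i)" for i using I by simp
  \<comment> \<open>For nonempty \<open>A\<close>, the parking condition at
    \<open>i = card A - 1\<close> already puts every value on \<open>A\<close> at or below
    \<open>a (card A - 1)\<close>.\<close>
  have below: "A \<subseteq> ?c (card A)" if A: "?P A" for A
  proof (cases "card A")
    case 0
    then show ?thesis using A I finite_subset by fastforce
  next
    case (Suc k)
    have "finite A" using A I finite_subset by blast
    have "k < card {j \<in> A. f j \<le> a k}" using A Suc by auto
    then have *: "{j \<in> A. f j \<le> a k} = A"
      using Suc \<open>finite A\<close> by (intro card_seteq) auto
    have "a k \<le> a (card A)" using Suc by (intro monoD[OF a]) simp
    show ?thesis
    proof
      fix j assume "j \<in> A"
      then have "f j \<le> a k" using * by blast
      with \<open>a k \<le> a (card A)\<close> \<open>j \<in> A\<close> A show "j \<in> ?c (card A)" by auto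
    qed
  qed
  have eq: "A = ?c (card A)" if "?P A" for A
  proof (rule subset_antisym)
    show "A \<subseteq> ?c (card A)" by (rule below[OF that])
    show "?c (card A) \<subseteq> A"
    proof
      fix j assume "j \<in> ?c (card A)"
      then have "j \<in> I" "\<not> a (card A) < f j" by auto
      with that show "j \<in> A" by blast
    qed
  qed
  \<comment> \<open>Otherwise the condition for \<open>B\<close> at \<open>i = card A\<close>
    demands more than \<open>card A\<close> indices in \<open>?c (card A)\<close>, a set equal to
    \<open>A\<close>.\<close>
  have no_less: "\<not> card A < card B" if A: "?P A" and B: "?P B" for A B
  proof
    assume less: "card A < card B"
    then have "card A < card {j \<in> B. f j \<le> a (card A)}" using B by blast
    also have "\<dots> \<le> card (?c (card A))" using B by (intro card_mono fin) auto
    also have "\<dots> = card A" using eq[OF A] by simp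
    finally show False by simp
  qed
  have "\<exists>A. ?P A"
  proof (cases "\<forall>i<card I. i < card (?c i)")
    case True
    then have "?P I" by auto
    then show ?thesis by - (rule exI[where x = I])
  next
    case False
    then have ex: "\<exists>i. card (?c i) \<le> i" by (meson not_less)
    \<comment> \<open>At the first violation \<open>k\<close>, exactly \<open>k\<close> values are
      at most \<open>a k\<close>, since for \<open>k > 0\<close> at least \<open>k\<close> are
      already at most \<open>a (k - 1)\<close>. Their indices form the witness.\<close>
    define k where "k = (LEAST i. card (?c i) \<le> i)"
    have k: "card (?c k) \<le> k" unfolding k_def by (rule LeastI_ex[OF ex])
    have less: "i < card (?c i)" if "i < k" for i
      using not_less_Least[of i "\<lambda>i. card (?c i) \<le> i"] that k_def by auto
    have "k \<le> card (?c k)"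
    proof (cases k)
      case (Suc i)
      then have "k \<le> card (?c i)" using less[of i] by simp
      also have "\<dots> \<le> card (?c k)"
        using monoD[OF a, of i k] Suc by (intro card_mono fin) auto
      finally show ?thesis .
    qed simp
    with k have card: "card (?c k) = k" by simp
    have "{j \<in> ?c k. f j \<le> a i} = ?c i" if "i < k" for i
      using monoD[OF a, of i k] that by auto
    then have "?P (?c k)" using less card by auto
    then show ?thesis by - (rule exI[where x = "?c k"])
  qed
  moreover have "A = B" if "?P A" "?P B" for A B
  proof -
    have card: "card A = card B" 
      using no_less[OF that] no_less[OF that(2,1)] by (rule linorder_class.antisym_conv3[THEN iffD1, rotated])
    have "A = ?c (card A)" by (rule eq[OF that(1)])
    also have "\<dots> = ?c (card B)" by (simp only: card)
    also have "\<dots> = B" by (rule eq[OF that(2), symmetric])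
    finally show ?thesis .
  qed
  ultimately have "\<exists>!A. ?P A" by blast
  moreover have "(A \<subseteq> I \<and> restrict f A \<in> parking_maps N a A \<and> (\<forall>j\<in>I - A. a (card A) < f j)) = ?P A" for A
    using restrict_in_parking_maps_iff[OF f] by blast
  ultimately show ?thesis by simp
qed

text \<open>The right side is the weighted sum over all maps from \<open>I\<close> to
  \<open>{1..N}\<close>. Grouping them by the set \<open>A\<close> of
  \<open>ex1_maximal_parking_part\<close> makes each block factor into a parking map on
  \<open>A\<close> and free values above \<open>a (card A)\<close> on \<open>I - A\<close>.\<close>

lemma sum_signed_count:
  assumes I: "finite I" and a: "mono a"
  shows "(\<Sum>A\<in>Pow I. signed_count N a A * (\<Sum>x\<in>{a (card A)<..N}. (-1) ^ (x + 1)) ^ card (I - A))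
    = (\<Sum>x\<in>{1..N}. (-1) ^ (x + 1)) ^ card I"
proof -
  let ?w = "\<lambda>x::nat. (-1) ^ (x + 1) :: int"
  let ?R = "\<lambda>A f. restrict f A \<in> parking_maps N a A \<and> (\<forall>j\<in>I - A. a (card A) < f j)"
  let ?E = "I \<rightarrow>\<^sub>E {1..N}"
  have finE: "finite ?E" using I by (simp add: finite_PiE)
  have part: "signed_count N a A * (\<Sum>x\<in>{a (card A)<..N}. ?w x) ^ card (I - A)
      = (\<Sum>f\<in>{f \<in> ?E. ?R A f}. \<Prod>j\<in>I. ?w (f j))" if A: "A \<in> Pow I" for A
  proof -
    let ?J = "{a (card A)<..N}"
    have finA: "finite A" using A I finite_subset by blast
    have "(\<Sum>x\<in>?J. ?w x) ^ card (I - A) = (\<Prod>j\<in>I - A. \<Sum>x\<in>?J. ?w x)" by simp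
    also have "\<dots> = (\<Sum>h\<in>(I - A) \<rightarrow>\<^sub>E ?J. \<Prod>j\<in>I - A. ?w (h j))"
      using I by (intro prod_sum_PiE) auto
    finally have "signed_count N a A * (\<Sum>x\<in>?J. ?w x) ^ card (I - A)
        = (\<Sum>(g, h)\<in>parking_maps N a A \<times> ((I - A) \<rightarrow>\<^sub>E ?J). (\<Prod>j\<in>A. ?w (g j)) * (\<Prod>j\<in>I - A. ?w (h j)))"
      by (simp add: signed_count_def sum_product sum.cartesian_product)
    also have "\<dots> = (\<Sum>f\<in>{f \<in> ?E. ?R A f}. \<Prod>j\<in>I. ?w (f j))"
    proof (rule sum.reindex_bij_witness[where j = "\<lambda>(g, h) j. if j \<in> A then g j else h j"
          and i = "\<lambda>f. (restrict f A, restrict f (I - A))"])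
      fix p assume p: "p \<in> parking_maps N a A \<times> ((I - A) \<rightarrow>\<^sub>E ?J)"
      obtain g h where gh: "p = (g, h)" by (cases p)
      have g: "g \<in> parking_maps N a A" "g \<in> A \<rightarrow>\<^sub>E {1..N}" and h: "h \<in> (I - A) \<rightarrow>\<^sub>E ?J"
        using p gh by (auto simp: parking_maps_def)
      let ?f = "\<lambda>j. if j \<in> A then g j else h j"
      have rg: "restrict ?f A = g" using g(2) by (auto simp: fun_eq_iff PiE_iff extensional_def)
      have rh: "restrict ?f (I - A) = h" using h by (auto simp: fun_eq_iff PiE_iff extensional_def)
      have fE: "?f \<in> ?E"
      proof (rule PiE_I)
        fix j assume "j \<in> I"
        then show "?f j \<in> {1..N}" using PiE_mem[OF g(2), of j] PiE_mem[OF h, of j] by (cases "j \<in> A") auto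
      next
        fix j assume "j \<notin> I"
        then show "?f j = undefined" using PiE_arb[OF h, of j] A by auto
      qed
      show "(restrict (case p of (g, h) \<Rightarrow> \<lambda>j. if j \<in> A then g j else h j) A,
          restrict (case p of (g, h) \<Rightarrow> \<lambda>j. if j \<in> A then g j else h j) (I - A)) = p"
        using rg rh gh by simp
      have "\<forall>j\<in>I - A. a (card A) < ?f j" using h by (auto simp: PiE_iff)
      then show "(case p of (g, h) \<Rightarrow> \<lambda>j. if j \<in> A then g j else h j) \<in> {f \<in> ?E. ?R A f}"
        using gh fE rg g(1) by simp
      have "(\<Prod>j\<in>I. ?w (?f j)) = (\<Prod>j\<in>I - A. ?w (?f j)) * (\<Prod>j\<in>A. ?w (?f j))"
        using A I by (intro prod.subset_diff) auto
      also have "\<dots> = (\<Prod>j\<in>A. ?w (g j)) * (\<Prod>j\<in>I - A. ?w (h j))"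
        by (simp add: mult.commute)
      finally show "(\<Prod>j\<in>I. ?w ((case p of (g, h) \<Rightarrow> \<lambda>j. if j \<in> A then g j else h j) j))
          = (case p of (g, h) \<Rightarrow> (\<Prod>j\<in>A. ?w (g j)) * (\<Prod>j\<in>I - A. ?w (h j)))"
        using gh by simp
    next
      fix f assume f: "f \<in> {f \<in> ?E. ?R A f}"
      then show "(case (restrict f A, restrict f (I - A)) of (g, h) \<Rightarrow> \<lambda>j. if j \<in> A then g j else h j) = f"
        using A by (auto simp: fun_eq_iff PiE_iff extensional_def)
      show "(restrict f A, restrict f (I - A)) \<in> parking_maps N a A \<times> ((I - A) \<rightarrow>\<^sub>E ?J)"
        using f A by (auto simp: PiE_iff)
    qed
    finally show ?thesis .
  qed
  have "(\<Sum>A\<in>Pow I. signed_count N a A * (\<Sum>x\<in>{a (card A)<..N}. ?w x) ^ card (I - A))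
      = (\<Sum>A\<in>Pow I. \<Sum>f\<in>{f \<in> ?E. ?R A f}. \<Prod>j\<in>I. ?w (f j))"
    by (intro sum.cong part) auto
  \<comment> \<open>After the exchange, the weight of \<open>f\<close> is counted once for each
    admissible \<open>A\<close>, and there is exactly one.\<close>
  also have "\<dots> = (\<Sum>f\<in>?E. \<Sum>A\<in>{A \<in> Pow I. ?R A f}. \<Prod>j\<in>I. ?w (f j))"
    using finE I by (intro sum.swap_restrict) auto
  also have "\<dots> = (\<Sum>f\<in>?E. \<Prod>j\<in>I. ?w (f j))"
  proof (rule sum.cong[OF refl])
    fix f assume "f \<in> ?E"
    from ex1_maximal_parking_part[OF I a this]
    obtain B where B: "B \<subseteq> I \<and> ?R B f" and uniq: "\<And>A. A \<subseteq> I \<and> ?R A f \<Longrightarrow> A = B"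
      by (elim ex1E) (rule that, assumption, blast)
    have "{A \<in> Pow I. ?R A f} = {B}" using B uniq by blast
    then show "(\<Sum>A\<in>{A \<in> Pow I. ?R A f}. \<Prod>j\<in>I. ?w (f j)) = (\<Prod>j\<in>I. ?w (f j))"
      by (simp only:) simp
  qed
  also have "\<dots> = (\<Prod>j\<in>I. \<Sum>x\<in>{1..N}. ?w x)"
    using I by (intro prod_sum_PiE[symmetric]) auto
  finally show ?thesis by (simp only: prod_constant)
qed

text \<open>Downward induction on \<open>m\<close> from the empty sum at \<open>m = N\<close>, where
  the evenness of \<open>N\<close> enters.\<close>

lemma sum_alternating:
  assumes "m \<le> N" "even N"
  shows "(\<Sum>x\<in>{m<..N}. (-1) ^ (x + 1)) = - (of_bool (odd m) :: int)"
  using assms(1)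
proof (induction m rule: inc_induct)
  case base
  then show ?case using assms by simp
next
  case (step m)
  then have "{m<..N} = insert (Suc m) {Suc m<..N}" by auto
  with step show ?case by simp
qed

section \<open>The recursion for the signed count and its solution\<close>

text \<open>For even \<open>N\<close> and nonempty \<open>I\<close> the right side of
  \<open>sum_signed_count\<close> is \<open>0\<close>. The summand for \<open>A = I\<close> has
  exponent \<open>0\<close>, so it is the count itself, and the other summands are moved
  across.\<close>

lemma signed_count_recursion:
  assumes I: "finite I" "I \<noteq> {}" and a: "mono a" and N: "even N" "\<And>i. a i \<le> N"
  shows "signed_count N a I
    = - (\<Sum>A | A \<subset> I \<and> odd (a (card A)). (-1) ^ card (I - A) * signed_count N a A)"
proof -
  let ?t = "\<lambda>A. signed_count N a A * (- (of_bool (odd (a (card A))))) ^ card (I - A)"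
  have "(\<Sum>x\<in>{1..N}. (-1) ^ (x + 1)) = (0 :: int)"
    using sum_alternating[of 0 N] N(1) by (simp add: atLeastSucAtMost_greaterThanAtMost)
  moreover have "card I \<noteq> 0" using I by auto
  ultimately have "(\<Sum>A\<in>Pow I. ?t A) = 0"
    using sum_signed_count[OF I(1) a, of N] sum_alternating[OF N(2) N(1)] by (simp add: power_0_left)
  moreover have "Pow I = insert I {A. A \<subset> I}" by auto
  moreover have fin: "finite {A. A \<subset> I}"
    by (rule finite_subset[of _ "Pow I"]) (use I(1) in auto)
  ultimately have "signed_count N a I + (\<Sum>A | A \<subset> I. ?t A) = 0"
    using I by simp
  moreover have "(\<Sum>A | A \<subset> I. ?t A)
      = (\<Sum>A | A \<subset> I \<and> odd (a (card A)). (-1) ^ card (I - A) * signed_count N a A)"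
  proof (rule sum.mono_neutral_cong_right)
    \<comment> \<open>The exponent is positive for a proper subset, so an even bound makes the power
      vanish.\<close>
    show "\<forall>A\<in>{A. A \<subset> I} - {A. A \<subset> I \<and> odd (a (card A))}. ?t A = 0"
    proof
      fix A assume A: "A \<in> {A. A \<subset> I} - {A. A \<subset> I \<and> odd (a (card A))}"
      then have "card (I - A) \<noteq> 0" using I(1) by auto
      with A show "?t A = 0" by (simp add: power_0_left)
    qed
  qed (use fin in auto)
  ultimately show ?thesis by simp
qed

text \<open>Every summand of the recursion vanishes: the empty set is excluded because
  \<open>a 0\<close> is even, and nonempty proper subsets have count \<open>0\<close> by
  induction.\<close>

lemma signed_count_eq_0:
  assumes "finite I" "I \<noteq> {}" "mono a" "even N" "\<And>i. a i \<le> N" "even (a 0)"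
  shows "signed_count N a I = 0"
  using assms(1,2)
proof (induction I rule: finite_psubset_induct)
  case (psubset I)
  have "signed_count N a A = 0" if "A \<subset> I" "odd (a (card A))" for A
    using psubset.IH[OF that(1)] that assms(6) by force
  then show ?case using signed_count_recursion[OF psubset(1,3) assms(3-5)] by simp
qed

text \<open>Once the subsets are grouped by size, \<open>signed_count_recursion\<close> and the
  induction hypothesis give \<open>card_perms_with_descents_recursion\<close> up to signs.\<close>

lemma signed_count_odd:
  assumes "finite I" "mono a" "even N" "\<And>i. a i \<le> N" "odd (a 0)"
  shows "signed_count N a I = (-1) ^ (\<Sum>i<card I. a i + 1)
    * int (card (perms_with_descents I {i \<in> {1..<card I}. odd (a i)}))"
  using assms(1)
proof (induction I rule: finite_psubset_induct)
  case (psubset I)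
  let ?S = "\<lambda>n. {i \<in> {1..<n}. odd (a i)}"
  let ?e = "\<lambda>n. \<Sum>i<n. a i + 1"
  let ?D = "\<lambda>A T. int (card (perms_with_descents A T))"
  show ?case
  proof (cases "I = {}")
    case True
    then show ?thesis by (simp add: signed_count_empty perms_with_descents_empty)
  next
    case False
    define n where "n = card I"
    have n: "n > 0" using False psubset(1) by (auto simp: n_def)
    let ?K = "insert 0 (?S n)"
    \<comment> \<open>As \<open>a 0\<close> is odd, the sizes allowed in the recursion are exactly
      \<open>0\<close> and the elements of \<open>?S n\<close>.\<close>
    have K: "k \<in> ?K \<longleftrightarrow> k < n \<and> odd (a k)" for k using n assms(5) by (cases k) auto
    have sign: "- ((-1) ^ (n - k) * (-1) ^ ?e k) = ((-1) ^ ?e n * (-1) ^ card {s \<in> ?S n. k < s} :: int)"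
      if k: "k \<in> ?K" for k
    proof -
      \<comment> \<open>Parity induction from \<open>m = k + 1\<close>, where the oddness of
        \<open>a k\<close> is needed. Passing to \<open>m + 1\<close> adds \<open>1\<close> from
        \<open>m - k\<close>, \<open>a m + 1\<close> from \<open>?e m\<close>, and a further
        \<open>1\<close> exactly when \<open>a m\<close> is odd.\<close>
      have "even (1 + (m - k) + ?e k + ?e m + card {s \<in> ?S m. k < s})" if "Suc k \<le> m" for m
        using that
      proof (induction m rule: dec_induct)
        case base
        have none: "card {s \<in> ?S (Suc k). k < s} = 0" by (auto simp: card_eq_0_iff)
        have "odd (a k)" using k K by blast
        then show ?case unfolding none by simp
      next
        case (step m)
        have "{s \<in> ?S (Suc m). k < s}
            = (if odd (a m) then insert m {s \<in> ?S m. k < s} else {s \<in> ?S m. k < s})"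
          using step.hyps by (auto simp: less_Suc_eq)
        then show ?case using step by (auto simp: Suc_diff_le)
      qed
      from this[of n] k K show ?thesis
        by (cases "even (n - k)"; cases "even (?e k)"; cases "even (?e n)")
          (auto simp: minus_one_power_iff)
    qed
    let ?P = "{A. A \<subset> I \<and> odd (a (card A))}"
    have "signed_count N a I = (\<Sum>A\<in>?P. - ((-1) ^ card (I - A) * signed_count N a A))"
      using signed_count_recursion[OF psubset(1) False assms(2-4)] by (simp add: sum_negf)
    also have "\<dots> = (\<Sum>A\<in>?P. - ((-1) ^ (n - card A) * (-1) ^ ?e (card A)) * ?D A (?S (card A)))"
    proof (rule sum.cong[OF refl])
      fix A assume "A \<in> ?P"
      then have "A \<subset> I" by blast
      then show "- ((-1) ^ card (I - A) * signed_count N a A)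
          = - ((-1) ^ (n - card A) * (-1) ^ ?e (card A)) * ?D A (?S (card A))"
        using psubset.IH[of A] card_Diff_subset[of A I] finite_subset[of A I] psubset(1) by (simp add: n_def)
    qed
    also have "\<dots> = (\<Sum>k\<in>?K. \<Sum>A | A \<in> ?P \<and> card A = k.
        - ((-1) ^ (n - card A) * (-1) ^ ?e (card A)) * ?D A (?S (card A)))"
    proof (rule sum.group[symmetric])
      show "card ` ?P \<subseteq> ?K"
      proof (rule image_subsetI)
        fix A assume "A \<in> ?P"
        then show "card A \<in> ?K" unfolding K using psubset(1) by (simp add: n_def psubset_card_mono)
      qed
    next
      show "finite ?P" by (rule finite_subset[of _ "Pow I"]) (use psubset(1) in auto)
    qed simp
    also have "\<dots> = (\<Sum>k\<in>?K. (-1) ^ ?e n * ((-1) ^ card {s \<in> ?S n. k < s} *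
        (\<Sum>A | A \<subseteq> I \<and> card A = k. ?D A (?S n \<inter> {..<k}))))"
    proof (rule sum.cong[OF refl])
      fix k assume k: "k \<in> ?K"
      then have "k < n" "odd (a k)" using K by auto
      \<comment> \<open>As \<open>k < card I\<close>, a subset of size \<open>k\<close> is
        automatically proper.\<close>
      then have "?S n \<inter> {..<k} = ?S k" "{A. A \<in> ?P \<and> card A = k} = {A. A \<subseteq> I \<and> card A = k}"
        by (auto simp: n_def)
      then show "(\<Sum>A | A \<in> ?P \<and> card A = k.
          - ((-1) ^ (n - card A) * (-1) ^ ?e (card A)) * ?D A (?S (card A)))
        = (-1) ^ ?e n * ((-1) ^ card {s \<in> ?S n. k < s} *
          (\<Sum>A | A \<subseteq> I \<and> card A = k. ?D A (?S n \<inter> {..<k})))"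
        using sign[OF k] by (simp add: sum_distrib_left mult.assoc[symmetric])
    qed
    also have "\<dots> = (-1) ^ ?e n * ?D I (?S n)"
      unfolding sum_distrib_left[symmetric]
      by (subst card_perms_with_descents_recursion[OF psubset(1), of "?S n"]) (auto simp: n_def)
    finally show ?thesis by (simp add: n_def)
  qed
qed

section \<open>From parking maps back to lists\<close>

text \<open>Sorting preserves the number of entries at most \<open>c\<close>, and in the sorted list
  these form an initial segment.\<close>

lemma sort_nth_le_iff:
  fixes xs :: "'a :: linorder list"
  assumes "i < length xs"
  shows "sort xs ! i \<le> c \<longleftrightarrow> i < card {j. j < length xs \<and> xs ! j \<le> c}"
proof -
  let ?s = "sort xs"
  have "length (filter (\<lambda>x. x \<le> c) xs) = length (filter (\<lambda>x. x \<le> c) ?s)"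
    by (simp only: size_mset[symmetric] mset_filter mset_sort)
  then have eq: "card {j. j < length xs \<and> xs ! j \<le> c} = card {j. j < length ?s \<and> ?s ! j \<le> c}"
    by (simp only: length_filter_conv_card)
  show ?thesis unfolding eq
  proof
    assume "?s ! i \<le> c"
    then have "{..i} \<subseteq> {j. j < length ?s \<and> ?s ! j \<le> c}"
      using assms sorted_nth_mono[OF sorted_sort] order_trans by fastforce
    then have "card {..i} \<le> card {j. j < length ?s \<and> ?s ! j \<le> c}" by (rule card_mono[rotated]) simp
    then show "i < card {j. j < length ?s \<and> ?s ! j \<le> c}" by simp
  next
    assume *: "i < card {j. j < length ?s \<and> ?s ! j \<le> c}"
    show "?s ! i \<le> c"
    proof (rule ccontr)
      assume "\<not> ?s ! i \<le> c"
      then have "{j. j < length ?s \<and> ?s ! j \<le> c} \<subseteq> {..<i}"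
        using sorted_nth_mono[OF sorted_sort, of i] by (fastforce simp: not_le[symmetric])
      then have "card {j. j < length ?s \<and> ?s ! j \<le> c} \<le> card {..<i}" by (rule card_mono[rotated]) simp
      with * show False by simp
    qed
  qed
qed

text \<open>A list is read as a map on \<open>{1..length a}\<close>, with indices shifted by one.
  The function \<open>c\<close> extends the bounds to all naturals, as \<open>signed_count\<close>
  expects.\<close>

lemma poly_parking_enumerator_minus_one:
  assumes le: "\<And>i. i < length a \<Longrightarrow> a ! i = c i" "\<And>i. c i \<le> N"
  shows "poly (parking_enumerator a) (-1) = signed_count N c {1..length a}"
proof -
  let ?n = "length a"
  let ?f = "\<lambda>b. \<lambda>j\<in>{1..?n}. b ! (j - 1)"
  have card_eq: "card {j \<in> {1..?n}. f j \<le> x} = card {j. j < ?n \<and> f (Suc j) \<le> x}" for f :: "nat \<Rightarrow> nat" and x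
    by (rule bij_betw_same_card[symmetric, of Suc], rule bij_betwI[where g = "\<lambda>j. j - 1"]) auto
  have mem: "b \<in> parking_functions a \<longleftrightarrow> ?f b \<in> parking_maps N c {1..?n}" if b: "length b = ?n" for b
  proof -
    have iff: "(\<forall>i<?n. sort b ! i \<le> a ! i) \<longleftrightarrow>
        (\<forall>i<card {1..?n}. i < card {j \<in> {1..?n}. ?f b j \<le> c i})"
    proof -
      have "sort b ! i \<le> a ! i \<longleftrightarrow> i < card {j \<in> {1..?n}. ?f b j \<le> c i}" if "i < ?n" for i
      proof -
        have "{j \<in> {1..?n}. ?f b j \<le> c i} = {j \<in> {1..?n}. b ! (j - 1) \<le> c i}" by auto
        then show ?thesis
          using sort_nth_le_iff[of i b "c i"] card_eq[of "\<lambda>j. b ! (j - 1)" "c i"] that b le(1) by simp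
      qed
      then show ?thesis by simp
    qed
    \<comment> \<open>Each entry is at most some \<open>a ! i\<close>, hence at most
      \<open>N\<close>, so the cap in \<open>parking_maps\<close> excludes nothing.\<close>
    have bound: "x \<le> N" if "x \<in> set b" "\<forall>i<?n. sort b ! i \<le> a ! i" for x
    proof -
      from that(1) have "x \<in> set (sort b)" by simp
      then obtain i where "i < ?n" "x = sort b ! i" using b by (metis in_set_conv_nth length_sort)
      then show ?thesis using that(2) le by (metis order_trans)
    qed
    have "?f b \<in> {1..?n} \<rightarrow>\<^sub>E {1..N} \<longleftrightarrow> (\<forall>x\<in>set b. x \<in> {1..N})"
    proof -
      have "(\<forall>j\<in>{1..?n}. b ! (j - 1) \<in> {1..N}) \<longleftrightarrow> (\<forall>j<?n. b ! j \<in> {1..N})"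
      proof (intro iffI ballI allI impI)
        fix j assume h: "\<forall>j\<in>{1..?n}. b ! (j - 1) \<in> {1..N}" "j < ?n"
        then show "b ! j \<in> {1..N}" using bspec[OF h(1), of "Suc j"] by simp
      next
        fix j assume h: "\<forall>j<?n. b ! j \<in> {1..N}" "j \<in> {1..?n}"
        then have "j - 1 < ?n" by auto
        with h(1) show "b ! (j - 1) \<in> {1..N}" by blast
      qed
      then show ?thesis using b by (simp add: PiE_iff all_set_conv_all_nth)
    qed
    then show ?thesis
      using b iff bound unfolding parking_functions_def parking_maps_def by fastforce
  qed
  have "poly (parking_enumerator a) (-1) = (\<Sum>b\<in>parking_functions a. (-1) ^ (sum_list b - ?n))"
    by (simp add: parking_enumerator_def poly_sum poly_monom)
  also have "\<dots> = signed_count N c {1..?n}"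
    unfolding signed_count_def
  proof (rule sum.reindex_bij_witness[where j = ?f and i = "\<lambda>f. map f [1..<Suc ?n]"])
    fix b assume b: "b \<in> parking_functions a"
    then have len: "length b = ?n" and pos: "\<forall>x\<in>set b. 0 < x" by (auto simp: parking_functions_def)
    show "map (?f b) [1..<Suc ?n] = b"
      by (rule nth_equalityI) (auto simp: len simp del: upt_Suc)
    show "?f b \<in> parking_maps N c {1..?n}" using mem[OF len] b by blast
    \<comment> \<open>Positivity makes the subtraction exact, so the exponent has the parity of
      \<open>sum_list b + ?n\<close>, which splits over the entries.\<close>
    have "length b \<le> sum_list b" using pos by (induction b) auto
    then have "(-1) ^ (sum_list b - ?n) = ((-1) ^ (sum_list b + ?n) :: int)"
      using len by (simp add: minus_one_power_iff)
    also have "sum_list b + ?n = (\<Sum>j<?n. b ! j + 1)"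
      by (simp add: sum_list_sum_nth len sum_Suc atLeast0LessThan)
    also have "(-1) ^ \<dots> = (\<Prod>j<?n. (-1) ^ (b ! j + 1) :: int)"
      by (rule power_sum)
    also have "\<dots> = (\<Prod>j\<in>{1..?n}. (-1) ^ (?f b j + 1))"
      by (rule prod.reindex_bij_witness[where j = Suc and i = "\<lambda>j. j - 1"]) auto
    finally show "(\<Prod>j\<in>{1..?n}. (-1) ^ (?f b j + 1)) = ((-1) ^ (sum_list b - ?n) :: int)" by simp
  next
    fix f assume f: "f \<in> parking_maps N c {1..?n}"
    show fb: "?f (map f [1..<Suc ?n]) = f"
      using f by (auto simp: parking_maps_def fun_eq_iff PiE_iff extensional_def simp del: upt_Suc)
    show "map f [1..<Suc ?n] \<in> parking_functions a"
      by (subst mem) (use fb f in \<open>simp_all del: upt_Suc\<close>)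
  qed
  finally show ?thesis .
qed

theorem theorem2p4:
  fixes a :: "nat list" and n :: nat and S :: "nat set"
  assumes "length a = n" and "1 \<le> n"
    and "sorted a" and "\<forall>x\<in>set a. 0 < x"
    and "S = {i \<in> {1..<n}. odd (a ! i)}"
  shows "poly (parking_enumerator a) (-1) =
    (if even (a ! 0) then 0 else (-1) ^ (sum_list a - n) * int (beta n S))"
proof -
  \<comment> \<open>Repeating the last bound beyond index \<open>n - 1\<close> keeps
    \<open>c\<close> monotone and bounded.\<close>
  define c where "c i = a ! min i (n - 1)" for i
  \<comment> \<open>Twice the sum is even and at least every bound.\<close>
  let ?N = "2 * sum_list a"
  have "a ! i \<le> ?N" if "i < n" for i
    using member_le_sum_list[of "a ! i" a] that assms(1) by simp
  then have cN: "c i \<le> ?N" for i using assms(2) by (simp add: c_def)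
  have c: "c i = a ! i" if "i < n" for i using that by (simp add: c_def)
  have "mono c"
    unfolding c_def using assms(1,2,3) by (intro monoI sorted_nth_mono) auto
  have eq: "poly (parking_enumerator a) (-1) = signed_count ?N c {1..n}"
    using poly_parking_enumerator_minus_one[of a c ?N] c cN assms(1) by simp
  show ?thesis
  proof (cases "even (a ! 0)")
    case True
    then show ?thesis
      using signed_count_eq_0[OF _ _ \<open>mono c\<close> _ cN, of "{1..n}"] assms(2) c[of 0] eq by simp
  next
    case False
    \<comment> \<open>Hence \<open>sum_list a - n\<close> is exact and has the parity of
      \<open>sum_list a + n\<close>.\<close>
    have "length a \<le> sum_list a" using assms(4) by (induction a) auto
    moreover have "(\<Sum>i<n. c i + 1) = sum_list a + n"
      using c assms(1) by (simp add: sum_list_sum_nth sum_Suc atLeast0LessThan)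
    ultimately have "(-1) ^ (\<Sum>i<n. c i + 1) = ((-1) ^ (sum_list a - n) :: int)"
      using assms(1) by (simp add: minus_one_power_iff)
    moreover have "{i \<in> {1..<n}. odd (c i)} = S" using assms(5) c by auto
    ultimately show ?thesis
      using signed_count_odd[OF _ \<open>mono c\<close> _ cN, of "{1..n}"] assms(2) c[of 0] eq False
      by (simp add: beta_eq_card_perms_with_descents)
  qed
qed

end
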